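(* Let $r,p,n$ be positive integers with $p\mid r$, let $d=r/p$, let $q\in\mathbb{C}^*$, let $x_0,\ldots,x_{d-1}\in\mathbb{C}^*$, and let $\xi$ be a primitive $p$th root of unity. Put $u_j=\xi^k x_\ell$ for $j-1=\ell p+k$ with $0\le k\le p-1$, $0\le \ell\le d-1$. The group $\mathbb{Z}/p\mathbb{Z}=\{1,g,\ldots,g^{p-1}\}$ acts by algebra automorphisms on $H_{r,1,n}=H_{r,1,n}(u_1,\ldots,u_r;q)$ via $g(T_1)=\xi T_1$ and $g(T_i)=T_i$ for $2\le i\le n$, and the subalgebra $H_{r,p,n}=H_{r,p,n}(x_0,\ldots,x_{d-1};q)$ of $H_{r,1,n}$ is the fixed point subalgebra: $$H_{r,p,n}=(H_{r,1,n})^{\mathbb{Z}/p\mathbb{Z}}.$$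
   Context: For $u_1,\ldots,u_r,q\in\mathbb{C}$, $q\neq 0$, the cyclotomic Hecke algebra $H_{r,1,n}(u_1,\ldots,u_r;q)$ is the unital associative $\mathbb{C}$-algebra with generators $T_1,\ldots,T_n$ and relations: $T_iT_j=T_jT_i$ if $|i-j|>1$; $T_iT_{i+1}T_i=T_{i+1}T_iT_{i+1}$ for $2\le i\le n-1$; $T_1T_2T_1T_2=T_2T_1T_2T_1$; $(T_1-u_1)(T_1-u_2)\cdots(T_1-u_r)=0$; $(T_i-q)(T_i+q^{-1})=0$ for $2\le i\le n$. With $u_j$ chosen as in the claim, one has $(T_1-u_1)\cdots(T_1-u_r)=(T_1^p-x_0^p)\cdots(T_1^p-x_{d-1}^p)$. The algebra $H_{r,p,n}(x_0,\ldots,x_{d-1};q)$ is the subalgebra of $H_{r,1,n}(u_1,\ldots,u_r;q)$ generated by $a_0=T_1^p$, $a_1=T_1^{-1}T_2T_1$, and $a_i=T_i$ for $2\le i\le n$ (for $n=1$, by $a_0$ only). *)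

theory Defs
  imports Complex_Main "HOL-Algebra.QuotRing" "HOL-Algebra.Subrings"
    "HOL-Algebra.Elementary_Groups" "HOL-Algebra.Group_Action" "HOL-Library.Poly_Mapping"
begin

section \<open>Free associative algebras over the complex numbers\<close>

text \<open>Noncommutative monomials, written additively: \<open>Poly_Mapping\<close> builds its convolution
  product from the additive monoid structure on the keys.\<close>

datatype 'x monomial = Monomial (letters: "'x list")

instantiation monomial :: (type) monoid_add
begin

definition zero_monomial :: "'a monomial" where
  "0 = Monomial []"

definition plus_monomial :: "'a monomial \<Rightarrow> 'a monomial \<Rightarrow> 'a monomial" where
  "v + w = Monomial (letters v @ letters w)"

instance
  by standard (simp_all add: zero_monomial_def plus_monomial_def)

end

type_synonym 'x ncpoly = "'x monomial \<Rightarrow>\<^sub>0 complex"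

definition nc_var :: "'x \<Rightarrow> 'x ncpoly" where
  "nc_var i = Poly_Mapping.single (Monomial [i]) 1"

definition nc_const :: "complex \<Rightarrow> 'x ncpoly" where
  "nc_const c = Poly_Mapping.single 0 c"

text \<open>The library's locale \<open>algebra\<close> is restricted to commutative rings, so only its record type
  is used here for (not necessarily commutative) algebras.\<close>

definition free_algebra :: "'x set \<Rightarrow> (complex, 'x ncpoly) module" where
  "free_algebra V =
    \<lparr>carrier = {f. \<forall>w \<in> Poly_Mapping.keys f. set (letters w) \<subseteq> V},
     monoid.mult = (*), one = 1, ring.zero = 0, add = (+),
     smult = (\<lambda>c f. Poly_Mapping.map ((*) c) f)\<rparr>"

section \<open>Algebras given by generators and relations\<close>

definition quotient_algebra :: "(complex, 'b) module \<Rightarrow> 'b set \<Rightarrow> (complex, 'b set) module" where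
  "quotient_algebra A I =
    ring.extend (A Quot I)
      (module.fields (\<lambda>c B. \<Union>b\<in>B. I +>\<^bsub>A\<^esub> (c \<odot>\<^bsub>A\<^esub> b)))"

text \<open>A relation \<open>a = b\<close> is represented by the element \<open>a - b\<close>.
  Ideals in \<open>HOL-Algebra\<close> are two-sided.\<close>

definition presented_algebra :: "'x set \<Rightarrow> 'x ncpoly set \<Rightarrow> (complex, 'x ncpoly set) module" where
  "presented_algebra V R = quotient_algebra (free_algebra V) (Idl\<^bsub>free_algebra V\<^esub> R)"

definition presented_gen :: "'x set \<Rightarrow> 'x ncpoly set \<Rightarrow> 'x \<Rightarrow> 'x ncpoly set" where
  "presented_gen V R i = (Idl\<^bsub>free_algebra V\<^esub> R) +>\<^bsub>free_algebra V\<^esub> nc_var i"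

section \<open>Subalgebras and actions by algebra automorphisms\<close>

definition is_subalgebra :: "'b set \<Rightarrow> (complex, 'b) module \<Rightarrow> bool" where
  "is_subalgebra B A \<longleftrightarrow> subring B A \<and> (\<forall>c. \<forall>b\<in>B. c \<odot>\<^bsub>A\<^esub> b \<in> B)"

definition generated_subalgebra :: "(complex, 'b) module \<Rightarrow> 'b set \<Rightarrow> 'b set" where
  "generated_subalgebra A S = \<Inter>{B. is_subalgebra B A \<and> S \<subseteq> B}"

definition algebra_aut :: "(complex, 'b) module \<Rightarrow> ('b \<Rightarrow> 'b) set" where
  "algebra_aut A =
    {f \<in> ring_iso A A. \<forall>c. \<forall>a\<in>carrier A. f (c \<odot>\<^bsub>A\<^esub> a) = c \<odot>\<^bsub>A\<^esub> f a}"

definition algebra_action ::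
  "('g, 'm) monoid_scheme \<Rightarrow> (complex, 'b) module \<Rightarrow> ('g \<Rightarrow> 'b \<Rightarrow> 'b) \<Rightarrow> bool" where
  "algebra_action G A \<phi> \<longleftrightarrow>
    group_action G (carrier A) \<phi> \<and> (\<forall>g\<in>carrier G. \<phi> g \<in> algebra_aut A)"

definition fixed_points ::
  "('g, 'm) monoid_scheme \<Rightarrow> (complex, 'b) module \<Rightarrow> ('g \<Rightarrow> 'b \<Rightarrow> 'b) \<Rightarrow> 'b set" where
  "fixed_points G A \<phi> = {a \<in> carrier A. \<forall>g\<in>carrier G. \<phi> g a = a}"

section \<open>Cyclotomic Hecke algebras\<close>

definition hecke_relations ::
  "nat \<Rightarrow> nat \<Rightarrow> (nat \<Rightarrow> complex) \<Rightarrow> complex \<Rightarrow> nat ncpoly set" where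
  "hecke_relations r n u q =
    (let T = nc_var; C = nc_const in
      {T i * T j - T j * T i | i j. i \<in> {1..n} \<and> j \<in> {1..n} \<and> \<bar>int i - int j\<bar> > 1}
    \<union> {T i * T (i + 1) * T i - T (i + 1) * T i * T (i + 1) | i. 2 \<le> i \<and> i + 1 \<le> n}
    \<union> (if 2 \<le> n then {T 1 * T 2 * T 1 * T 2 - T 2 * T 1 * T 2 * T 1} else {})
    \<union> {\<Prod>j\<leftarrow>[1..<r + 1]. T 1 - C (u j)}
    \<union> {(T i - C q) * (T i + C (inverse q)) | i. 2 \<le> i \<and> i \<le> n})"

definition hecke_r1n ::
  "nat \<Rightarrow> nat \<Rightarrow> (nat \<Rightarrow> complex) \<Rightarrow> complex \<Rightarrow> (complex, nat ncpoly set) module" where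
  "hecke_r1n r n u q = presented_algebra {1..n} (hecke_relations r n u q)"

definition hecke_gen ::
  "nat \<Rightarrow> nat \<Rightarrow> (nat \<Rightarrow> complex) \<Rightarrow> complex \<Rightarrow> nat \<Rightarrow> nat ncpoly set" where
  "hecke_gen r n u q i = presented_gen {1..n} (hecke_relations r n u q) i"

text \<open>The inverse of \<open>T\<^sub>1\<close> is taken in the multiplicative monoid of the algebra; it exists as soon
  as all \<open>u\<^sub>j\<close> are nonzero.\<close>

definition hecke_rpn ::
  "nat \<Rightarrow> nat \<Rightarrow> nat \<Rightarrow> (nat \<Rightarrow> complex) \<Rightarrow> complex \<Rightarrow> nat ncpoly set set" where
  "hecke_rpn r p n u q =
    (let H = hecke_r1n r n u q; T = hecke_gen r n u q in
      generated_subalgebra H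
        ({T 1 [^]\<^bsub>H\<^esub> p}
         \<union> (if 2 \<le> n then {inv\<^bsub>H\<^esub> (T 1) \<otimes>\<^bsub>H\<^esub> T 2 \<otimes>\<^bsub>H\<^esub> T 1} else {})
         \<union> T ` {2..n}))"

definition primitive_root_of_unity :: "nat \<Rightarrow> complex \<Rightarrow> bool" where
  "primitive_root_of_unity p \<xi> \<longleftrightarrow> p > 0 \<and> \<xi> ^ p = 1 \<and> (\<forall>k. 0 < k \<and> k < p \<longrightarrow> \<xi> ^ k \<noteq> 1)"

text \<open>The generator \<open>g\<close> of the cyclic group is the residue class of \<open>1\<close>, which for \<open>p = 1\<close> is
  represented by \<open>0\<close>.\<close>

definition twist_action ::
  "nat \<Rightarrow> nat \<Rightarrow> nat \<Rightarrow> (nat \<Rightarrow> complex) \<Rightarrow> complex \<Rightarrow> complex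
    \<Rightarrow> (int \<Rightarrow> nat ncpoly set \<Rightarrow> nat ncpoly set) \<Rightarrow> bool" where
  "twist_action r p n u q \<xi> \<phi> \<longleftrightarrow>
    (let H = hecke_r1n r n u q; T = hecke_gen r n u q; g = 1 mod int p in
      algebra_action (integer_mod_group p) H \<phi>
      \<and> \<phi> g (T 1) = \<xi> \<odot>\<^bsub>H\<^esub> T 1
      \<and> (\<forall>i\<in>{2..n}. \<phi> g (T i) = T i))"

end

(* Let B = H_{r,p,n} and T = T_1. The relation T T_2 T T_2 = T_2 T T_2 T gives
   T T_2 T^{-1} = T_2^{-1} a_1 T_2, so T B T^{-1} is contained in B, and every element of H_{r,1,n}
   is a sum of terms b T^k with b in B. The generator g acts on b T^k by \<xi>^k, so averaging over the
   group leaves exactly the terms with p | k, and these lie in B because T^p does.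
   The action exists because rescaling T_1 by \<xi> in the free algebra multiplies every relation by a
   scalar: on the cyclotomic relation it only rotates each block of factors T_1 - \<xi>^k x_l. *)

theory Submission
  imports Defs
begin

section \<open>Associative algebras and fixed points\<close>

text \<open>The terms b T^k are not known to be independent for different k, so a fixed element
  cannot be compared with its image coefficient by coefficient. The sum over the orbit avoids this:
  it is additive, sends each b T^k into B, and multiplies a fixed element by p, which is invertible
  in the complex numbers. Two inverses carry the rest. T_1 is invertible because the constant term
  of the cyclotomic relation is, up to sign, the product of the nonzero u_j. The quadratic relation
  gives T_2^{-1} = T_2 + (q^{-1} - q), which therefore lies in B. On the other generators
  conjugation by T is easy: a_1 goes to T_2, while T^p and the T_i with i \<ge> 3 commute with T.
  The inclusion is used in the form T B \<subseteq> B T, which moves powers of T to the right.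
  Equality is proved for every action with the prescribed values, not just for the one
  constructed.\<close>

locale assoc_algebra = ring A for A :: "(complex, 'b) module" (structure) +
  assumes smult_closed [simp, intro]: "a \<in> carrier A \<Longrightarrow> c \<odot> a \<in> carrier A"
    and smult_l_distr: "a \<in> carrier A \<Longrightarrow> (c + d) \<odot> a = c \<odot> a \<oplus> d \<odot> a"
    and smult_assoc: "a \<in> carrier A \<Longrightarrow> (c * d) \<odot> a = c \<odot> (d \<odot> a)"
    and smult_one [simp]: "a \<in> carrier A \<Longrightarrow> 1 \<odot> a = a"
    and smult_mult_left: "\<lbrakk>a \<in> carrier A; b \<in> carrier A\<rbrakk> \<Longrightarrow> (c \<odot> a) \<otimes> b = c \<odot> (a \<otimes> b)"
    and smult_mult_right: "\<lbrakk>a \<in> carrier A; b \<in> carrier A\<rbrakk> \<Longrightarrow> a \<otimes> (c \<odot> b) = c \<odot> (a \<otimes> b)"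
begin

text \<open>Scaling by \<open>c\<close> is left multiplication by \<open>c \<odot> \<one>\<close>,
  so this is ring distributivity.\<close>

lemma smult_r_distr:
  assumes "a \<in> carrier A" "b \<in> carrier A"
  shows "c \<odot> (a \<oplus> b) = c \<odot> a \<oplus> c \<odot> b"
proof -
  have "c \<odot> (a \<oplus> b) = (c \<odot> \<one>) \<otimes> (a \<oplus> b)"
    using assms by (simp add: smult_mult_left)
  also have "\<dots> = c \<odot> a \<oplus> c \<odot> b"
    using assms by (simp add: r_distr smult_mult_left)
  finally show ?thesis .
qed

lemma zero_smult [simp]: "a \<in> carrier A \<Longrightarrow> 0 \<odot> a = \<zero>"
  using smult_l_distr[of a 0 0] by (metis add.l_cancel_one' add_0 smult_closed)

lemma smult_pow:
  assumes "a \<in> carrier A"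
  shows "(c \<odot> a) [^] (k::nat) = c ^ k \<odot> a [^] k"
  using assms
  by (induction k) (simp_all add: smult_mult_left smult_mult_right smult_assoc[symmetric] mult.commute)

lemma is_subalgebraI:
  assumes "B \<subseteq> carrier A" "\<one> \<in> B"
    and "\<And>a b. \<lbrakk>a \<in> B; b \<in> B\<rbrakk> \<Longrightarrow> a \<oplus> b \<in> B"
    and "\<And>a b. \<lbrakk>a \<in> B; b \<in> B\<rbrakk> \<Longrightarrow> a \<otimes> b \<in> B"
    and sm: "\<And>c b. b \<in> B \<Longrightarrow> c \<odot> b \<in> B"
  shows "is_subalgebra B A"
proof -
  have "\<ominus> b \<in> B" if "b \<in> B" for b
  proof -
    have b: "b \<in> carrier A" using that assms(1) by blast
    have "b \<oplus> (-1) \<odot> b = \<zero>"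
      using smult_l_distr[OF b, of 1 "-1"] b by simp
    hence "\<ominus> b = (-1) \<odot> b"
      using b by (metis add.inv_equality a_comm smult_closed)
    thus ?thesis using sm[OF that] by simp
  qed
  hence "subring B A"
    using assms by (intro subringI) auto
  thus ?thesis using sm by (simp add: is_subalgebra_def)
qed

lemma is_subalgebraD:
  assumes "is_subalgebra B A"
  shows "B \<subseteq> carrier A" "\<one> \<in> B"
    "\<And>a b. \<lbrakk>a \<in> B; b \<in> B\<rbrakk> \<Longrightarrow> a \<oplus> b \<in> B"
    "\<And>a b. \<lbrakk>a \<in> B; b \<in> B\<rbrakk> \<Longrightarrow> a \<otimes> b \<in> B"
    "\<And>c b. b \<in> B \<Longrightarrow> c \<odot> b \<in> B"
  using assms subringE[of B A] by (auto simp: is_subalgebra_def)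

lemma subalgebra_carrier: "is_subalgebra (carrier A) A"
  by (rule is_subalgebraI) auto

lemma generated_subalgebra:
  assumes "S \<subseteq> carrier A"
  shows "is_subalgebra (generated_subalgebra A S) A"
proof (rule is_subalgebraI)
  show "generated_subalgebra A S \<subseteq> carrier A"
    using subalgebra_carrier assms by (auto simp: generated_subalgebra_def)
qed (auto simp: generated_subalgebra_def is_subalgebraD(2) intro: is_subalgebraD(3-5))

lemma generated_subalgebra_incl: "S \<subseteq> generated_subalgebra A S"
  by (auto simp: generated_subalgebra_def)

lemma generated_subalgebra_minimal:
  "\<lbrakk>is_subalgebra B A; S \<subseteq> B\<rbrakk> \<Longrightarrow> generated_subalgebra A S \<subseteq> B"
  by (auto simp: generated_subalgebra_def)

lemma algebra_autD:
  assumes "f \<in> algebra_aut A"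
  shows "\<And>a. a \<in> carrier A \<Longrightarrow> f a \<in> carrier A" "f \<one> = \<one>"
    "\<And>a b. \<lbrakk>a \<in> carrier A; b \<in> carrier A\<rbrakk> \<Longrightarrow> f (a \<oplus> b) = f a \<oplus> f b"
    "\<And>a b. \<lbrakk>a \<in> carrier A; b \<in> carrier A\<rbrakk> \<Longrightarrow> f (a \<otimes> b) = f a \<otimes> f b"
    "\<And>c a. a \<in> carrier A \<Longrightarrow> f (c \<odot> a) = c \<odot> f a"
  using assms by (auto simp: algebra_aut_def ring_iso_def dest: ring_hom_memE)

lemma algebra_aut_pow:
  assumes "f \<in> algebra_aut A" "a \<in> carrier A"
  shows "f (a [^] (k::nat)) = f a [^] k"
  using assms by (induction k) (auto simp: algebra_autD[OF assms(1)])

text \<open>Reduces invariance of a generated subalgebra to invariance of its generators.\<close>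

lemma subalgebra_equalizer:
  assumes "f \<in> algebra_aut A"
  shows "is_subalgebra {a \<in> carrier A. f a = a} A"
  by (rule is_subalgebraI) (auto simp: algebra_autD[OF assms])

text \<open>The condition expresses t b t^{-1} \<in> B without an inverse. Being a subalgebra
  condition, it can be checked on generators of \<open>B\<close>.\<close>

lemma subalgebra_conjugate_into:
  assumes B: "is_subalgebra B A" and t: "t \<in> carrier A"
  shows "is_subalgebra {b \<in> carrier A. \<exists>b'\<in>B. t \<otimes> b = b' \<otimes> t} A"
proof -
  note Bc = is_subalgebraD(1)[OF B, THEN subsetD] and Bs = is_subalgebraD[OF B]
  show ?thesis
  proof (rule is_subalgebraI, goal_cases)
    case 1 show ?case by blast
  next
    case 2
    have "t \<otimes> \<one> = \<one> \<otimes> t" using t by simp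
    thus ?case using Bs(2) by auto
  next
    case (3 a b)
    then obtain a' b' where "a' \<in> B" "b' \<in> B" "t \<otimes> a = a' \<otimes> t" "t \<otimes> b = b' \<otimes> t" by auto
    hence "t \<otimes> (a \<oplus> b) = (a' \<oplus> b') \<otimes> t" "a' \<oplus> b' \<in> B"
      using 3 t Bs(3) by (auto simp: l_distr r_distr Bc)
    thus ?case using 3 by auto
  next
    case (4 a b)
    then obtain a' b' where ab: "a' \<in> B" "b' \<in> B" "t \<otimes> a = a' \<otimes> t" "t \<otimes> b = b' \<otimes> t" by auto
    have "t \<otimes> (a \<otimes> b) = (t \<otimes> a) \<otimes> b" using 4 t by (simp add: m_assoc)
    also have "\<dots> = a' \<otimes> (t \<otimes> b)" using 4 t ab(1,3) by (simp add: m_assoc Bc)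
    also have "\<dots> = (a' \<otimes> b') \<otimes> t" using t ab by (simp add: m_assoc Bc)
    finally show ?case using 4 Bs(4)[OF ab(1,2)] by auto
  next
    case (5 c b)
    then obtain b' where b: "b' \<in> B" "t \<otimes> b = b' \<otimes> t" by auto
    have "t \<otimes> (c \<odot> b) = (c \<odot> b') \<otimes> t"
      using 5 t b by (simp add: smult_mult_left smult_mult_right Bc)
    thus ?case using 5 Bs(5)[OF b(1)] by auto
  qed
qed

end

section \<open>Sums of terms b t^k over a subalgebra, and averaging over an orbit\<close>

inductive_set pow_span :: "(complex, 'b) module \<Rightarrow> 'b set \<Rightarrow> 'b \<Rightarrow> 'b set" for A B t where
  base: "b \<in> B \<Longrightarrow> b \<otimes>\<^bsub>A\<^esub> t [^]\<^bsub>A\<^esub> (k::nat) \<in> pow_span A B t"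
| add: "\<lbrakk>x \<in> pow_span A B t; y \<in> pow_span A B t\<rbrakk> \<Longrightarrow> x \<oplus>\<^bsub>A\<^esub> y \<in> pow_span A B t"

text \<open>The averaging operator without its factor 1/p. Leaving the length \<open>m\<close> free
  lets its properties be proved by induction before setting it to \<open>p\<close>.\<close>

primrec orbit_sum :: "(complex, 'b) module \<Rightarrow> ('b \<Rightarrow> 'b) \<Rightarrow> nat \<Rightarrow> 'b \<Rightarrow> 'b" where
  "orbit_sum A f 0 a = \<zero>\<^bsub>A\<^esub>"
| "orbit_sum A f (Suc m) a = orbit_sum A f m a \<oplus>\<^bsub>A\<^esub> (f ^^ m) a"

text \<open>Orthogonality of characters of the cyclic group: if p does not divide k, then \<xi>^k is
  a pth root of unity other than 1, and its geometric sum of length p vanishes.\<close>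

lemma sum_powers_root_of_unity:
  assumes "primitive_root_of_unity p \<xi>"
  shows "(\<Sum>i<p. (\<xi> ^ k) ^ i) = (if p dvd k then of_nat p else 0)"
proof (cases "p dvd k")
  case True
  hence "\<xi> ^ k = 1" using assms by (auto simp: primitive_root_of_unity_def power_mult)
  thus ?thesis using True by simp
next
  case False
  have p: "p > 0" "\<xi> ^ p = 1" using assms by (auto simp: primitive_root_of_unity_def)
  have "\<xi> ^ k = \<xi> ^ (p * (k div p) + k mod p)" by simp
  also have "\<dots> = \<xi> ^ (k mod p)" using p by (simp only: power_add power_mult) simp
  also have "\<dots> \<noteq> 1"
    using False assms by (auto simp: primitive_root_of_unity_def mod_greater_zero_iff_not_dvd)
  finally have "\<xi> ^ k \<noteq> 1" .
  moreover have "(\<xi> ^ k) ^ p = 1" using p by (metis power_commutes power_mult power_one mult.commute)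
  ultimately show ?thesis using False by (simp add: geometric_sum)
qed

context assoc_algebra
begin

context
  fixes B t
  assumes B: "is_subalgebra B A" and t: "t \<in> carrier A"
begin

private lemma Bc: "b \<in> B \<Longrightarrow> b \<in> carrier A"
  using is_subalgebraD(1)[OF B] by blast

lemma pow_span_carrier: "x \<in> pow_span A B t \<Longrightarrow> x \<in> carrier A"
  by (induction rule: pow_span.induct) (auto simp: Bc t)

lemma pow_commute_past:
  assumes comm: "\<And>b. b \<in> B \<Longrightarrow> \<exists>b'\<in>B. t \<otimes> b = b' \<otimes> t" and "b \<in> B"
  shows "\<exists>b'\<in>B. t [^] (k::nat) \<otimes> b = b' \<otimes> t [^] k"
  using \<open>b \<in> B\<close>
proof (induction k arbitrary: b)
  case 0
  thus ?case by (intro bexI[of _ b]) (auto simp: Bc)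
next
  case (Suc k)
  obtain b' where b': "b' \<in> B" "t \<otimes> b = b' \<otimes> t" using comm Suc.prems by blast
  obtain b'' where b'': "b'' \<in> B" "t [^] k \<otimes> b' = b'' \<otimes> t [^] k" using Suc.IH b'(1) by blast
  have "t [^] Suc k \<otimes> b = t [^] k \<otimes> (t \<otimes> b)" using t Suc.prems by (simp add: m_assoc Bc)
  also have "\<dots> = (t [^] k \<otimes> b') \<otimes> t" using t b' by (simp add: m_assoc Bc)
  also have "\<dots> = b'' \<otimes> t [^] Suc k" using t b'' by (simp add: m_assoc Bc)
  finally show ?case using b''(1) by blast
qed

text \<open>Moving t^k past a coefficient replaces that coefficient by another element of
  \<open>B\<close>, so (b t^k)(b2 t^l) = (b b') t^(k+l). Scalars are absorbed into the coefficient,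
  and sums are handled by induction in each factor separately.\<close>

lemma subalgebra_pow_span:
  assumes comm: "\<And>b. b \<in> B \<Longrightarrow> \<exists>b'\<in>B. t \<otimes> b = b' \<otimes> t"
  shows "is_subalgebra (pow_span A B t) A"
proof (rule is_subalgebraI)
  show "pow_span A B t \<subseteq> carrier A" using pow_span_carrier by blast
  show "\<one> \<in> pow_span A B t" using pow_span.base[of \<one> B A t 0] is_subalgebraD(2)[OF B] by simp
next
  fix x y assume xy: "x \<in> pow_span A B t" "y \<in> pow_span A B t"
  thus "x \<oplus> y \<in> pow_span A B t" by (rule pow_span.add)
  from xy show "x \<otimes> y \<in> pow_span A B t"
  proof (induction rule: pow_span.induct)
    case (base b k)
    from base(2) show ?case
    proof (induction rule: pow_span.induct)
      case (base b2 l)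
      obtain b' where b': "b' \<in> B" "t [^] k \<otimes> b2 = b' \<otimes> t [^] k"
        using pow_commute_past[OF comm base(1)] by blast
      have "b \<otimes> t [^] k \<otimes> (b2 \<otimes> t [^] l) = b \<otimes> (t [^] k \<otimes> b2) \<otimes> t [^] l"
        using \<open>b \<in> B\<close> base t by (simp add: m_assoc Bc)
      also have "\<dots> = (b \<otimes> b') \<otimes> t [^] (k + l)"
        using \<open>b \<in> B\<close> b' t by (simp add: m_assoc Bc nat_pow_mult)
      finally show ?case
        using pow_span.base is_subalgebraD(4)[OF B \<open>b \<in> B\<close> b'(1)] by metis
    next
      case (add x y)
      thus ?case using \<open>b \<in> B\<close> t by (simp add: r_distr Bc pow_span_carrier pow_span.add)
    qed
  next
    case (add x x')
    thus ?case by (simp add: l_distr pow_span_carrier pow_span.add)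
  qed
next
  fix c x assume "x \<in> pow_span A B t"
  thus "c \<odot> x \<in> pow_span A B t"
  proof (induction rule: pow_span.induct)
    case (base b k)
    have "c \<odot> (b \<otimes> t [^] k) = (c \<odot> b) \<otimes> t [^] k" using base t by (simp add: smult_mult_left Bc)
    thus ?case using pow_span.base is_subalgebraD(5)[OF B base] by metis
  next
    case (add x y)
    thus ?case by (simp add: smult_r_distr pow_span_carrier pow_span.add)
  qed
qed

lemma pow_span_eq_carrier:
  assumes comm: "\<And>b. b \<in> B \<Longrightarrow> \<exists>b'\<in>B. t \<otimes> b = b' \<otimes> t"
    and gen: "generated_subalgebra A (insert t B) = carrier A"
  shows "pow_span A B t = carrier A"
proof
  show "pow_span A B t \<subseteq> carrier A" using pow_span_carrier by blast
  have "t \<in> pow_span A B t"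
    using pow_span.base[of \<one> B A t 1] is_subalgebraD(2)[OF B] t by simp
  moreover have "b \<in> pow_span A B t" if "b \<in> B" for b
    using pow_span.base[OF that, of A t 0] that by (simp add: Bc)
  ultimately show "carrier A \<subseteq> pow_span A B t"
    using generated_subalgebra_minimal[OF subalgebra_pow_span[OF comm], of "insert t B"] gen by auto
qed

text \<open>Each b t^k is an eigenvector of \<open>f\<close> with eigenvalue \<xi>^k, so its orbit
  sum is p b t^k or 0. In the first case t^k is a power of t^p.\<close>

lemma orbit_sum_pow_span:
  assumes f: "f \<in> algebra_aut A" and ft: "f t = \<xi> \<odot> t" and fB: "\<And>b. b \<in> B \<Longrightarrow> f b = b"
    and \<xi>: "primitive_root_of_unity p \<xi>" and tp: "t [^] p \<in> B"
    and x: "x \<in> pow_span A B t"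
  shows "orbit_sum A f p x \<in> B"
proof -
  note fD = algebra_autD[OF f]
  have fm: "(f ^^ m) y \<in> carrier A" if "y \<in> carrier A" for m y
    using that by (induction m) (auto simp: fD)
  have os: "orbit_sum A f m y \<in> carrier A" if "y \<in> carrier A" for m y
    using that by (induction m) (auto simp: fm)
  show ?thesis
    using x
  proof (induction rule: pow_span.induct)
    case (base b k)
    let ?y = "b \<otimes> t [^] k"
    have y: "?y \<in> carrier A" using base t by (simp add: Bc)
    have *: "(f ^^ m) ?y = (\<xi> ^ k) ^ m \<odot> ?y" for m
    proof (induction m)
      case (Suc m)
      have "f ?y = \<xi> ^ k \<odot> ?y"
        using base t by (simp add: fD Bc fB algebra_aut_pow[OF f] ft smult_pow smult_mult_right)
      thus ?case using Suc y by (simp add: fD smult_assoc[symmetric] mult.commute)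
    qed (use y in simp)
    have "orbit_sum A f m ?y = (\<Sum>i<m. (\<xi> ^ k) ^ i) \<odot> ?y" for m
      using y by (induction m) (simp_all only: orbit_sum.simps * sum.lessThan_Suc smult_l_distr
          sum.empty lessThan_0 zero_smult)
    hence eq: "orbit_sum A f p ?y = (if p dvd k then of_nat p else 0) \<odot> ?y"
      by (simp only: sum_powers_root_of_unity[OF \<xi>])
    show ?case
    proof (cases "p dvd k")
      case True
      then obtain j where j: "k = p * j" by blast
      have "(t [^] p) [^] i \<in> B" for i :: nat
        by (induction i) (auto simp: is_subalgebraD(2,4)[OF B] tp)
      hence "t [^] k \<in> B" using t by (simp add: nat_pow_pow j)
      thus ?thesis
        using base eq True by (simp add: is_subalgebraD(4,5)[OF B])
    next
      case False
      \<comment> \<open>Zero belongs to \<open>B\<close> as a scalar multiple of one.\<close>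
      have "0 \<odot> \<one> \<in> B" by (rule is_subalgebraD(5)[OF B is_subalgebraD(2)[OF B]])
      thus ?thesis using eq False y by simp
    qed
  next
    case (add x y)
    have c: "x \<in> carrier A" "y \<in> carrier A" using add.hyps pow_span_carrier by auto
    have fmadd: "(f ^^ m) (x \<oplus> y) = (f ^^ m) x \<oplus> (f ^^ m) y" for m
      by (induction m) (simp_all add: fD fm c)
    have "orbit_sum A f m (x \<oplus> y) = orbit_sum A f m x \<oplus> orbit_sum A f m y" for m
      by (induction m) (simp_all add: fmadd a_ac fm os c)
    thus ?case using add.IH by (simp add: is_subalgebraD(3)[OF B])
  qed
qed

text \<open>The orbit sum of a fixed element \<open>a\<close> is p a, and it lies in
  \<open>B\<close>; dividing by p puts \<open>a\<close> itself in \<open>B\<close>.\<close>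

lemma fixed_points_eq_subalgebra:
  assumes comm: "\<And>b. b \<in> B \<Longrightarrow> \<exists>b'\<in>B. t \<otimes> b = b' \<otimes> t"
    and gen: "generated_subalgebra A (insert t B) = carrier A"
    and f: "f \<in> algebra_aut A" and ft: "f t = \<xi> \<odot> t" and fB: "\<And>b. b \<in> B \<Longrightarrow> f b = b"
    and \<xi>: "primitive_root_of_unity p \<xi>" and tp: "t [^] p \<in> B"
  shows "{a \<in> carrier A. f a = a} = B"
proof
  show "B \<subseteq> {a \<in> carrier A. f a = a}" using fB Bc by auto
  show "{a \<in> carrier A. f a = a} \<subseteq> B"
  proof clarify
    fix a assume a: "a \<in> carrier A" "f a = a"
    have fm: "(f ^^ m) a = a" for m using a by (induction m) auto
    have "orbit_sum A f m a = of_nat m \<odot> a" for m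
    proof (induction m)
      case (Suc m)
      have "of_nat (Suc m) \<odot> a = (of_nat m + 1) \<odot> a" by (simp add: add.commute)
      thus ?case using Suc a fm by (simp only: orbit_sum.simps smult_l_distr smult_one)
    qed (use a in simp)
    moreover have "orbit_sum A f p a \<in> B"
      using orbit_sum_pow_span[OF f ft fB \<xi> tp] pow_span_eq_carrier[OF comm gen] a by blast
    ultimately have "inverse (of_nat p) \<odot> (of_nat p \<odot> a) \<in> B"
      using is_subalgebraD(5)[OF B] by simp
    moreover have "inverse (of_nat p) * of_nat p = (1 :: complex)"
      using \<xi> by (simp add: primitive_root_of_unity_def)
    ultimately show "a \<in> B" using a by (simp add: smult_assoc[symmetric])
  qed
qed

end

section \<open>The fixed-point theorem for an abstract algebra with Hecke-type relations\<close>

lemma twist_fixed_points_eq_generated: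
  fixes s :: "nat \<Rightarrow> 'b"
  assumes t: "t \<in> Units A" and s: "\<And>i. i \<in> {2..n} \<Longrightarrow> s i \<in> carrier A"
    and far: "\<And>i. i \<in> {3..n} \<Longrightarrow> t \<otimes> s i = s i \<otimes> t"
    and braid: "2 \<le> n \<Longrightarrow> t \<otimes> s 2 \<otimes> t \<otimes> s 2 = s 2 \<otimes> t \<otimes> s 2 \<otimes> t"
    and quad: "2 \<le> n \<Longrightarrow> (s 2 \<oplus> c \<odot> \<one>) \<otimes> s 2 = \<one>"
    and gen: "generated_subalgebra A (insert t (s ` {2..n})) = carrier A"
    and f: "f \<in> algebra_aut A" and ft: "f t = \<xi> \<odot> t" and fs: "\<And>i. i \<in> {2..n} \<Longrightarrow> f (s i) = s i"
    and \<xi>: "primitive_root_of_unity p \<xi>"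
  shows "generated_subalgebra A
      ({t [^] p} \<union> (if 2 \<le> n then {inv t \<otimes> s 2 \<otimes> t} else {}) \<union> s ` {2..n})
    = {a \<in> carrier A. f a = a}"
proof -
  note fD = algebra_autD[OF f]
  define a1 where "a1 = inv t \<otimes> s 2 \<otimes> t"
  define S where "S = {t [^] p} \<union> (if 2 \<le> n then {a1} else {}) \<union> s ` {2..n}"
  define B where "B = generated_subalgebra A S"
  have tc: "t \<in> carrier A" and itc: "inv t \<in> carrier A" using t by auto
  have a1c: "a1 \<in> carrier A" if "2 \<le> n" using that s tc itc by (auto simp: a1_def)
  have Sc: "S \<subseteq> carrier A" using a1c s tc by (auto simp: S_def split: if_splits)
  have B: "is_subalgebra B A" unfolding B_def by (rule generated_subalgebra[OF Sc])
  have SB: "S \<subseteq> B" unfolding B_def by (rule generated_subalgebra_incl)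
  have ta1: "t \<otimes> a1 = s 2 \<otimes> t" if "2 \<le> n"
    using that s[of 2] tc itc t by (simp add: a1_def m_assoc[symmetric])
  have "\<exists>b'\<in>B. t \<otimes> b = b' \<otimes> t" if "b \<in> S" for b
  proof -
    \<comment> \<open>Index 2 is split off from \<open>s\<close> because \<open>s 2\<close> is the
      one generator among them not assumed to commute with \<open>t\<close>.\<close>
    consider "b = t [^] p" | "2 \<le> n" "b = a1" | "2 \<le> n" "b = s 2" | i where "i \<in> {3..n}" "b = s i"
    proof -
      have "{2..n} = (if 2 \<le> n then {2} else {}) \<union> {3..n}" by auto
      hence "S = {t [^] p} \<union> (if 2 \<le> n then {a1, s 2} else {}) \<union> s ` {3..n}"
        by (simp add: S_def image_Un insert_commute)
      hence "b = t [^] p \<or> 2 \<le> n \<and> (b = a1 \<or> b = s 2) \<or> b \<in> s ` {3..n}"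
        using \<open>b \<in> S\<close> by (simp split: if_splits)
      thus ?thesis using that by (elim disjE conjE imageE)
    qed
    thus ?thesis
    proof cases
      case 1
      thus ?thesis using SB that tc by (metis nat_pow_comm nat_pow_eone subsetD)
    next
      case 2
      moreover have "s 2 \<in> B" using 2 SB by (auto simp: S_def)
      ultimately show ?thesis using ta1 by blast
    next
      case 3
      have s2: "s 2 \<in> carrier A" "s 2 \<in> B" "a1 \<in> B" "a1 \<in> carrier A"
        using 3 s SB a1c by (auto simp: S_def)
      let ?v = "s 2 \<oplus> c \<odot> \<one>"
      have v: "?v \<in> B" "?v \<in> carrier A" using s2 is_subalgebraD[OF B] by auto
      \<comment> \<open>Since t a1 = s2 t, the left side is s2 t s2 t, and the four-term relation
        turns it into t s2 t s2. The leading unit \<open>t\<close> is then cancelled.\<close>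
      have "t \<otimes> (a1 \<otimes> s 2 \<otimes> t) = t \<otimes> (s 2 \<otimes> t \<otimes> s 2)"
        using braid[OF 3(1)] s2 tc ta1[OF 3(1)] by (simp add: m_assoc[symmetric])
      hence *: "a1 \<otimes> s 2 \<otimes> t = s 2 \<otimes> t \<otimes> s 2"
        using t s2 tc by (simp add: Units_l_cancel)
      \<comment> \<open>By \<open>quad\<close>, \<open>?v\<close> is a left inverse of
        \<open>s 2\<close>. Inserting \<open>?v \<otimes> s 2\<close> creates the word s2 t s2,
        which \<open>*\<close> rewrites with \<open>t\<close> on the right.\<close>
      have "t \<otimes> s 2 = ?v \<otimes> s 2 \<otimes> (t \<otimes> s 2)"
        using quad[OF 3(1)] s2 tc by simp
      also have "\<dots> = ?v \<otimes> (s 2 \<otimes> t \<otimes> s 2)"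
        using v s2 tc by (simp only: m_assoc m_closed)
      also have "\<dots> = (?v \<otimes> (a1 \<otimes> s 2)) \<otimes> t"
        using v s2 tc by (simp only: *[symmetric] m_assoc m_closed)
      finally show ?thesis using 3 v s2 is_subalgebraD(4)[OF B] by metis
    next
      case 4
      moreover have "s i \<in> B" using 4 SB by (auto simp: S_def)
      ultimately show ?thesis using far by blast
    qed
  qed
  hence "S \<subseteq> {b \<in> carrier A. \<exists>b'\<in>B. t \<otimes> b = b' \<otimes> t}" using Sc by blast
  hence "B \<subseteq> {b \<in> carrier A. \<exists>b'\<in>B. t \<otimes> b = b' \<otimes> t}"
    using generated_subalgebra_minimal[OF subalgebra_conjugate_into[OF B tc]] B_def by blast
  hence comm: "\<exists>b'\<in>B. t \<otimes> b = b' \<otimes> t" if "b \<in> B" for b using that by blast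
  have "f b = b" if "b \<in> S" for b
  proof -
    consider "b = t [^] p" | "2 \<le> n" "b = a1" | i where "i \<in> {2..n}" "b = s i"
    proof -
      have "b = t [^] p \<or> 2 \<le> n \<and> b = a1 \<or> (\<exists>i\<in>{2..n}. b = s i)"
        using \<open>b \<in> S\<close> by (auto simp: S_def split: if_splits)
      thus ?thesis using that by blast
    qed
    thus ?thesis
    proof cases
      case 1
      thus ?thesis
        using \<xi> tc by (simp add: algebra_aut_pow[OF f] ft smult_pow primitive_root_of_unity_def)
    next
      case 2
      have \<xi>0: "\<xi> \<noteq> 0" using \<xi> by (auto simp: primitive_root_of_unity_def power_0_left)
      have fa: "f a1 \<in> carrier A" using a1c[OF 2(1)] fD by blast
      \<comment> \<open>Applying \<open>f\<close> to t a1 = s2 t gives \<xi> on both sides;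
        cancelling \<xi> and then \<open>t\<close> avoids computing \<open>f\<close> on the inverse
        of \<open>t\<close>.\<close>
      have "\<xi> \<odot> (t \<otimes> f a1) = f (t \<otimes> a1)"
        using tc a1c[OF 2(1)] fa by (simp add: fD ft smult_mult_left)
      also have "\<dots> = \<xi> \<odot> (t \<otimes> a1)"
        using ta1[OF 2(1)] tc s[of 2] fs[of 2] 2(1) by (simp add: fD ft smult_mult_right)
      finally have "inverse \<xi> \<odot> (\<xi> \<odot> (t \<otimes> f a1)) = inverse \<xi> \<odot> (\<xi> \<odot> (t \<otimes> a1))" by simp
      hence "t \<otimes> f a1 = t \<otimes> a1"
        using tc fa a1c[OF 2(1)] \<xi>0 by (simp add: smult_assoc[symmetric])
      thus ?thesis using t fa a1c[OF 2(1)] 2(2) by (simp add: Units_l_cancel)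
    next
      case 3
      thus ?thesis using fs by simp
    qed
  qed
  hence "B \<subseteq> {a \<in> carrier A. f a = a}"
    using generated_subalgebra_minimal[OF subalgebra_equalizer[OF f]] Sc B_def by blast
  hence fB: "f b = b" if "b \<in> B" for b using that by blast
  have tB: "insert t B \<subseteq> carrier A" using tc is_subalgebraD(1)[OF B] by blast
  \<comment> \<open>The \<open>s i\<close> already lie in \<open>B\<close>, so adjoining
    \<open>t\<close> to \<open>B\<close> recovers the whole algebra.\<close>
  have "insert t (s ` {2..n}) \<subseteq> generated_subalgebra A (insert t B)"
    using generated_subalgebra_incl[of "insert t B"] SB by (auto simp: S_def)
  hence "carrier A \<subseteq> generated_subalgebra A (insert t B)"
    using generated_subalgebra_minimal[OF generated_subalgebra[OF tB]] gen by blast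
  hence genB: "generated_subalgebra A (insert t B) = carrier A"
    using is_subalgebraD(1)[OF generated_subalgebra[OF tB]] by blast
  have "t [^] p \<in> B" using SB by (auto simp: S_def)
  from fixed_points_eq_subalgebra[OF B tc comm genB f ft fB \<xi> this] show ?thesis
    unfolding B_def S_def a1_def by simp
qed

end

section \<open>Free algebras\<close>

lemma nc_const_mult [simp]: "nc_const a * nc_const b = nc_const (a * b)"
  by (simp add: nc_const_def mult_single)

lemma nc_const_mult_assoc [simp]: "nc_const a * (nc_const b * f) = nc_const (a * b) * f"
  by (simp flip: mult.assoc)

lemma nc_const_add: "nc_const (a + b) = nc_const a + nc_const b"
  by (simp add: nc_const_def single_add)

lemma nc_const_1 [simp]: "nc_const 1 = 1"
  by (simp add: nc_const_def)

lemma single_Monomial_Cons: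
  "Poly_Mapping.single (Monomial (i # w)) c = nc_var i * Poly_Mapping.single (Monomial w) c"
  by (simp add: nc_var_def mult_single plus_monomial_def)

lemma single_Monomial_Nil: "Poly_Mapping.single (Monomial []) c = nc_const c"
  by (simp add: nc_const_def zero_monomial_def)

lemma free_algebra_simps [simp]:
  "f \<in> carrier (free_algebra V) \<longleftrightarrow> (\<forall>w\<in>Poly_Mapping.keys f. set (letters w) \<subseteq> V)"
  "f \<otimes>\<^bsub>free_algebra V\<^esub> g = f * g"
  "f \<oplus>\<^bsub>free_algebra V\<^esub> g = f + g"
  "\<one>\<^bsub>free_algebra V\<^esub> = 1"
  "\<zero>\<^bsub>free_algebra V\<^esub> = 0"
  "c \<odot>\<^bsub>free_algebra V\<^esub> f = nc_const c * f"
  by (simp_all add: free_algebra_def nc_const_def mult_map_scale_conv_mult)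

lemma nc_const_closed: "nc_const c \<in> carrier (free_algebra V)"
  by (simp add: nc_const_def zero_monomial_def)

lemma nc_var_closed: "i \<in> V \<Longrightarrow> nc_var i \<in> carrier (free_algebra V)"
  by (simp add: nc_var_def)

lemma free_algebra_add_closed:
  "\<lbrakk>f \<in> carrier (free_algebra V); g \<in> carrier (free_algebra V)\<rbrakk> \<Longrightarrow> f + g \<in> carrier (free_algebra V)"
  using keys_add[of f g] by auto

lemma free_algebra_diff_closed:
  "\<lbrakk>f \<in> carrier (free_algebra V); g \<in> carrier (free_algebra V)\<rbrakk> \<Longrightarrow> f - g \<in> carrier (free_algebra V)"
  using keys_diff[of f g] by auto

lemma free_algebra_mult_closed:
  "\<lbrakk>f \<in> carrier (free_algebra V); g \<in> carrier (free_algebra V)\<rbrakk> \<Longrightarrow> f * g \<in> carrier (free_algebra V)"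
  using keys_mult[of f g] by (fastforce simp: plus_monomial_def)

lemmas free_algebra_closed =
  nc_const_closed nc_var_closed free_algebra_add_closed free_algebra_diff_closed free_algebra_mult_closed

text \<open>An element is the finite sum of its own terms. Building this sum over subsets of the
  support keeps every word inside \<open>V\<close>.\<close>

lemma free_algebra_induct [consumes 1, case_names zero single add]:
  assumes "f \<in> carrier (free_algebra V)"
    and "P 0"
    and sg: "\<And>w c. set w \<subseteq> V \<Longrightarrow> P (Poly_Mapping.single (Monomial w) c)"
    and ad: "\<And>f g. \<lbrakk>P f; P g\<rbrakk> \<Longrightarrow> P (f + g)"
  shows "P f"
proof -
  have "P (\<Sum>w\<in>K. Poly_Mapping.single w (Poly_Mapping.lookup f w))"
    if "finite K" "K \<subseteq> Poly_Mapping.keys f" for K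
    using that
  proof (induction K)
    case (insert w K)
    have "P (Poly_Mapping.single w (Poly_Mapping.lookup f w))"
      using sg[of "letters w"] insert.prems assms(1) by simp
    thus ?case using insert ad by simp
  qed (use assms(2) in simp)
  moreover have "f = (\<Sum>w\<in>Poly_Mapping.keys f. Poly_Mapping.single w (Poly_Mapping.lookup f w))"
    by (rule poly_mapping_eqI)
       (simp add: lookup_sum lookup_single when_def in_keys_iff sum.delta)
  ultimately show ?thesis by (metis finite_keys subset_refl)
qed

lemma nc_const_commute: "f * nc_const c = nc_const c * f"
proof -
  \<comment> \<open>Allowing all letters makes the induction rule available for an arbitrary
    \<open>f\<close>.\<close>
  have "f \<in> carrier (free_algebra UNIV)" by simp
  thus ?thesis
    by (induction rule: free_algebra_induct)
       (simp_all add: nc_const_def mult_single mult.commute distrib_left distrib_right)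
qed

lemma nc_var_const_commute [simp]:
  "nc_var i * nc_const c = nc_const c * nc_var i"
  "nc_var i * (nc_const c * f) = nc_const c * (nc_var i * f)"
  by (metis nc_const_commute, metis nc_const_commute mult.assoc)

lemma assoc_algebra_free_algebra: "assoc_algebra (free_algebra V)"
proof -
  have "\<exists>y\<in>carrier (free_algebra V). y \<oplus>\<^bsub>free_algebra V\<^esub> x = \<zero>\<^bsub>free_algebra V\<^esub>"
    if "x \<in> carrier (free_algebra V)" for x :: "'a ncpoly"
    using that by (intro bexI[of _ "- x"]) auto
  hence "abelian_group (free_algebra V)"
    by (intro abelian_groupI)
       (auto simp: ac_simps simp del: free_algebra_simps(1) intro: free_algebra_closed, simp)
  moreover have "Group.monoid (free_algebra V)"
    by (rule monoidI)
       (auto simp: mult.assoc simp del: free_algebra_simps(1) intro: free_algebra_closed, simp add: zero_monomial_def)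
  ultimately have "ring (free_algebra V)"
    by (intro ringI) (auto simp: distrib_left distrib_right)
  thus ?thesis
    by (rule assoc_algebra.intro, unfold_locales)
       (auto simp: nc_const_add distrib_right mult.assoc simp del: free_algebra_simps(1) intro: free_algebra_closed,
         metis nc_const_commute mult.assoc)
qed

lemma generated_subalgebra_free_algebra:
  assumes B: "is_subalgebra B (free_algebra V)" and V: "nc_var ` V \<subseteq> B"
  shows "carrier (free_algebra V) \<subseteq> B"
proof
  interpret assoc_algebra "free_algebra V" by (rule assoc_algebra_free_algebra)
  note Bs = is_subalgebraD[OF B, simplified]
  fix f assume "f \<in> carrier (free_algebra V)"
  thus "f \<in> B"
  proof (induction rule: free_algebra_induct)
    case zero
    show ?case using Bs(5)[OF Bs(2), of 0] by (simp add: nc_const_def)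
  next
    case (single w c)
    thus ?case
    proof (induction w)
      case Nil
      show ?case using Bs(5)[OF Bs(2), of c] by (simp add: single_Monomial_Nil)
    next
      case (Cons i w)
      thus ?case using V Bs(4) by (auto simp: single_Monomial_Cons)
    qed
  next
    case (add f g)
    thus ?case by (rule Bs(3))
  qed
qed

section \<open>Quotient algebras\<close>

lemma quotient_algebra_simps [simp]:
  "carrier (quotient_algebra A I) = carrier (A Quot I)"
  "B \<otimes>\<^bsub>quotient_algebra A I\<^esub> C = B \<otimes>\<^bsub>A Quot I\<^esub> C"
  "B \<oplus>\<^bsub>quotient_algebra A I\<^esub> C = B \<oplus>\<^bsub>A Quot I\<^esub> C"
  "\<one>\<^bsub>quotient_algebra A I\<^esub> = \<one>\<^bsub>A Quot I\<^esub>"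
  "\<zero>\<^bsub>quotient_algebra A I\<^esub> = \<zero>\<^bsub>A Quot I\<^esub>"
  "c \<odot>\<^bsub>quotient_algebra A I\<^esub> B = (\<Union>b\<in>B. I +>\<^bsub>A\<^esub> (c \<odot>\<^bsub>A\<^esub> b))"
  by (simp_all add: quotient_algebra_def ring.defs module.defs)

context assoc_algebra
begin

context
  fixes I
  assumes I: "ideal I A"
begin

private abbreviation Q where "Q \<equiv> quotient_algebra A I"

lemma quotient_carrierE:
  assumes "B \<in> carrier Q"
  obtains a where "a \<in> carrier A" "B = I +> a"
  using assms by (auto simp: FactRing_def A_RCOSETS_def')

lemma coset_hom:
  "a \<in> carrier A \<Longrightarrow> I +> a \<in> carrier Q"
  "\<lbrakk>a \<in> carrier A; b \<in> carrier A\<rbrakk> \<Longrightarrow> (I +> a) \<otimes>\<^bsub>Q\<^esub> (I +> b) = I +> (a \<otimes> b)"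
  "\<lbrakk>a \<in> carrier A; b \<in> carrier A\<rbrakk> \<Longrightarrow> (I +> a) \<oplus>\<^bsub>Q\<^esub> (I +> b) = I +> (a \<oplus> b)"
  "\<one>\<^bsub>Q\<^esub> = I +> \<one>"
  using ring_hom_memE[OF ideal.rcos_ring_hom[OF I]] by auto

lemma coset_eq_iff:
  "\<lbrakk>a \<in> carrier A; b \<in> carrier A\<rbrakk> \<Longrightarrow> I +> a = I +> b \<longleftrightarrow> a \<ominus> b \<in> I"
  using quotient_eq_iff_same_a_r_cos[OF I] by simp

text \<open>A ring ideal absorbs \<open>c \<odot> \<one>\<close>, hence also scalars.\<close>

lemma ideal_smult_closed: "i \<in> I \<Longrightarrow> c \<odot> i \<in> I"
proof -
  assume i: "i \<in> I"
  hence ic: "i \<in> carrier A" using I by (meson ideal.Icarr)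
  have "c \<odot> i = (c \<odot> \<one>) \<otimes> i" using ic by (simp add: smult_mult_left)
  thus ?thesis using ideal.I_l_closed[OF I i, of "c \<odot> \<one>"] by simp
qed

text \<open>Scaling in the quotient is a union over all representatives. It collapses to one coset
  because c(i + a) and c a differ by c i, which is in \<open>I\<close>.\<close>

lemma coset_smult:
  assumes a: "a \<in> carrier A"
  shows "c \<odot>\<^bsub>Q\<^esub> (I +> a) = I +> (c \<odot> a)"
proof -
  have "I +> (c \<odot> (i \<oplus> a)) = I +> (c \<odot> a)" if i: "i \<in> I" for i
  proof -
    have ic: "i \<in> carrier A" using I i by (meson ideal.Icarr)
    have "c \<odot> (i \<oplus> a) \<ominus> c \<odot> a = c \<odot> i"
      using ic a by (simp add: smult_r_distr minus_eq a_assoc r_neg)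
    thus ?thesis using ic a ideal_smult_closed[OF i] by (simp add: coset_eq_iff)
  qed
  moreover have "\<zero> \<in> I" using I by (simp add: additive_subgroup.zero_closed ideal_def)
  ultimately show ?thesis
    unfolding quotient_algebra_simps by (auto simp: a_r_coset_def' intro!: bexI[of _ "\<zero>"])
qed

lemma assoc_algebra_quotient: "assoc_algebra Q"
proof -
  interpret Q: ring "A Quot I" by (rule ideal.quotient_is_ring[OF I])
  have "\<exists>y\<in>carrier Q. y \<oplus>\<^bsub>Q\<^esub> x = \<zero>\<^bsub>Q\<^esub>" if "x \<in> carrier Q" for x
    using that by (auto intro!: bexI[of _ "\<ominus>\<^bsub>A Quot I\<^esub> x"] Q.l_neg)
  hence "abelian_group Q"
    by (intro abelian_groupI) (auto simp: Q.a_ac)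
  moreover have "Group.monoid Q"
    by (rule monoidI) (auto simp: Q.m_assoc)
  ultimately have "ring Q"
    by (intro ringI) (auto simp: Q.l_distr Q.r_distr)
  thus ?thesis
    by (rule assoc_algebra.intro, unfold_locales)
       (auto elim!: quotient_carrierE simp: coset_smult coset_hom smult_l_distr smult_assoc
         smult_mult_left smult_mult_right simp del: quotient_algebra_simps)
qed

end
end

context assoc_algebra
begin

lemma quotient_aut:
  assumes I: "ideal I A" and \<theta>: "\<theta> \<in> algebra_aut A" and \<theta>I: "\<theta> ` I = I"
  shows "restrict (image \<theta>) (carrier (quotient_algebra A I)) \<in> algebra_aut (quotient_algebra A I)"
    and "\<And>a. a \<in> carrier A \<Longrightarrow> \<theta> ` (I +> a) = I +> \<theta> a"
proof -
  let ?Q = "quotient_algebra A I"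
  note \<theta>D = algebra_autD[OF \<theta>]
  note h = coset_hom[OF I]
  have Ic: "I \<subseteq> carrier A" using I by (meson ideal.Icarr subsetI)
  have bij: "bij_betw \<theta> (carrier A) (carrier A)"
    using \<theta> by (simp add: algebra_aut_def ring_iso_def)
  show im: "\<theta> ` (I +> a) = I +> \<theta> a" if "a \<in> carrier A" for a
  proof -
    have "\<theta> ` (I +> a) = (\<lambda>i. \<theta> i \<oplus> \<theta> a) ` I"
      using that Ic by (auto simp: a_r_coset_def' \<theta>D subset_eq image_iff)
    also have "\<dots> = (\<lambda>i. i \<oplus> \<theta> a) ` \<theta> ` I" by (simp add: image_image)
    finally show ?thesis by (auto simp: \<theta>I a_r_coset_def')
  qed
  let ?f = "restrict (image \<theta>) (carrier ?Q)"
  have f: "?f (I +> a) = I +> \<theta> a" if "a \<in> carrier A" for a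
    using im[OF that] h(1)[OF that] by simp
  have Qc: "B \<subseteq> carrier A" if "B \<in> carrier ?Q" for B
  proof -
    obtain a where "a \<in> carrier A" "B = I +> a" by (rule quotient_carrierE[OF I \<open>B \<in> carrier ?Q\<close>])
    thus ?thesis using a_r_coset_subset_G[OF Ic] by simp
  qed
  have "inj_on ?f (carrier ?Q)"
  proof (rule inj_onI)
    fix B C assume BC: "B \<in> carrier ?Q" "C \<in> carrier ?Q" "?f B = ?f C"
    hence "\<theta> ` B = \<theta> ` C" by (simp del: quotient_algebra_simps)
    thus "B = C"
      using inj_on_image_eq_iff[of \<theta> "carrier A" B C] bij Qc BC(1,2) by (simp add: bij_betw_def)
  qed
  moreover have "?f ` carrier ?Q = carrier ?Q"
  proof
    show "?f ` carrier ?Q \<subseteq> carrier ?Q"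
    proof clarify
      fix B assume "B \<in> carrier ?Q"
      then obtain a where a: "a \<in> carrier A" "B = I +> a" by (rule quotient_carrierE[OF I])
      show "?f B \<in> carrier ?Q"
        unfolding a(2) f[OF a(1)] by (rule h(1)[OF \<theta>D(1)[OF a(1)]])
    qed
    show "carrier ?Q \<subseteq> ?f ` carrier ?Q"
    proof
      fix B assume "B \<in> carrier ?Q"
      then obtain b where b: "b \<in> carrier A" "B = I +> b" by (rule quotient_carrierE[OF I])
      then obtain a where a: "a \<in> carrier A" "b = \<theta> a" using bij by (auto simp: bij_betw_def)
      show "B \<in> ?f ` carrier ?Q"
        using f[OF a(1)] h(1)[OF a(1)] b(2) a(2) by (metis image_eqI)
    qed
  qed
  ultimately have "bij_betw ?f (carrier ?Q) (carrier ?Q)" by (simp add: bij_betw_def)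
  thus "?f \<in> algebra_aut ?Q"
    unfolding algebra_aut_def
    by (auto intro!: ring_iso_memI elim!: quotient_carrierE[OF I] simp: f h coset_smult[OF I] \<theta>D
        simp del: quotient_algebra_simps restrict_apply restrict_apply')
qed

end

section \<open>Presented algebras\<close>

locale presentation =
  fixes V :: "'x set" and R :: "'x ncpoly set"
  assumes relations_closed: "R \<subseteq> carrier (free_algebra V)"
begin

abbreviation "F \<equiv> free_algebra V"
abbreviation "J \<equiv> Idl\<^bsub>F\<^esub> R"
abbreviation "P \<equiv> presented_algebra V R"
abbreviation "pr \<equiv> a_r_coset F J"

sublocale F: assoc_algebra F by (rule assoc_algebra_free_algebra)

lemma ideal: "ideal J F"
  using relations_closed by (rule F.genideal_ideal)

sublocale P: assoc_algebra P
  unfolding presented_algebra_def by (rule F.assoc_algebra_quotient[OF ideal])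

lemma presented_carrierE:
  assumes "B \<in> carrier P"
  obtains f where "f \<in> carrier F" "B = pr f"
  using F.quotient_carrierE[OF ideal] assms unfolding presented_algebra_def by blast

lemma pr_hom:
  "f \<in> carrier F \<Longrightarrow> pr f \<in> carrier P"
  "\<lbrakk>f \<in> carrier F; g \<in> carrier F\<rbrakk> \<Longrightarrow> pr (f * g) = pr f \<otimes>\<^bsub>P\<^esub> pr g"
  "\<lbrakk>f \<in> carrier F; g \<in> carrier F\<rbrakk> \<Longrightarrow> pr (f + g) = pr f \<oplus>\<^bsub>P\<^esub> pr g"
  "pr 1 = \<one>\<^bsub>P\<^esub>"
  "f \<in> carrier F \<Longrightarrow> pr (nc_const c * f) = c \<odot>\<^bsub>P\<^esub> pr f"
  using F.coset_hom[OF ideal] F.coset_smult[OF ideal] unfolding presented_algebra_def by auto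

lemma pr_relation:
  assumes fg: "f \<in> carrier F" "g \<in> carrier F" and "f - g \<in> R"
  shows "pr f = pr g"
proof -
  \<comment> \<open>Identifies the additive inverse of the record with the minus of
    \<open>Poly_Mapping\<close>, in which the relations are written.\<close>
  have "- g \<oplus>\<^bsub>F\<^esub> g = \<zero>\<^bsub>F\<^esub>" "- g \<in> carrier F" using fg by auto
  hence "\<ominus>\<^bsub>F\<^esub> g = - g" using F.minus_equality fg(2) by blast
  hence "f \<ominus>\<^bsub>F\<^esub> g = f - g" by (simp add: a_minus_def)
  moreover have "f - g \<in> J" using F.genideal_self[OF relations_closed] assms(3) by blast
  ultimately show ?thesis using F.coset_eq_iff[OF ideal fg] by simp
qed

lemma presented_gen_eq: "presented_gen V R i = pr (nc_var i)"
  by (simp add: presented_gen_def)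

text \<open>The preimage under \<open>pr\<close> of the generated subalgebra is a subalgebra of the
  free algebra containing all letters, hence everything.\<close>

lemma generated_subalgebra_gens: "generated_subalgebra P (presented_gen V R ` V) = carrier P"
proof -
  let ?S = "presented_gen V R ` V"
  have S: "?S \<subseteq> carrier P" by (auto simp: presented_gen_eq intro!: pr_hom nc_var_closed simp del: free_algebra_simps)
  define B where "B = generated_subalgebra P ?S"
  have B: "is_subalgebra B P" unfolding B_def by (rule P.generated_subalgebra[OF S])
  note Bs = P.is_subalgebraD[OF B]
  have "is_subalgebra {f \<in> carrier F. pr f \<in> B} F"
    by (rule F.is_subalgebraI)
       (use Bs in \<open>auto simp: pr_hom zero_monomial_def simp del: free_algebra_simps(1) intro: free_algebra_closed\<close>,
        use Bs(2) pr_hom(4) F.one_closed in auto)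
  moreover have "nc_var ` V \<subseteq> {f \<in> carrier F. pr f \<in> B}"
    using P.generated_subalgebra_incl[of ?S] nc_var_closed unfolding B_def
    by (auto simp: presented_gen_eq simp del: free_algebra_simps)
  ultimately have "carrier F \<subseteq> {f \<in> carrier F. pr f \<in> B}"
    by (rule generated_subalgebra_free_algebra)
  hence "carrier P \<subseteq> B" by (auto elim!: presented_carrierE simp del: free_algebra_simps)
  thus ?thesis using Bs(1) B_def by blast
qed

end

section \<open>Rescaling one letter\<close>

text \<open>This is the substitution sending the letter \<open>i\<close> to \<open>c\<close> times
  itself. Every word is an eigenvector, so the map is given by its eigenvalues; linearity and
  composition can then be checked pointwise.\<close>

definition rescale :: "'x \<Rightarrow> complex \<Rightarrow> 'x ncpoly \<Rightarrow> 'x ncpoly" where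
  "rescale i c f = Poly_Mapping.mapp (\<lambda>w a. c ^ count_list (letters w) i * a) f"

lemma lookup_rescale:
  "Poly_Mapping.lookup (rescale i c f) w = c ^ count_list (letters w) i * Poly_Mapping.lookup f w"
  by (simp add: rescale_def lookup_mapp when_def in_keys_iff)

lemma rescale_add [simp]: "rescale i c (f + g) = rescale i c f + rescale i c g"
  by (rule poly_mapping_eqI) (simp add: lookup_rescale lookup_add distrib_left)

lemma rescale_diff [simp]: "rescale i c (f - g) = rescale i c f - rescale i c g"
  by (rule poly_mapping_eqI) (simp add: lookup_rescale lookup_minus right_diff_distrib)

lemma rescale_0 [simp]: "rescale i c 0 = 0"
  by (rule poly_mapping_eqI) (simp add: lookup_rescale)

lemma rescale_single:
  "rescale i c (Poly_Mapping.single w a) = Poly_Mapping.single w (c ^ count_list (letters w) i * a)"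
  by (rule poly_mapping_eqI) (simp add: lookup_rescale lookup_single when_def)

lemma rescale_const [simp]: "rescale i c (nc_const a) = nc_const a"
  by (simp add: nc_const_def rescale_single zero_monomial_def)

lemma rescale_1 [simp]: "rescale i c 1 = 1"
  using rescale_const[of i c 1] by simp

lemma rescale_var [simp]:
  "rescale i c (nc_var j) = (if j = i then nc_const c * nc_var j else nc_var j)"
  by (simp add: nc_var_def nc_const_def rescale_single mult_single)

text \<open>Occurrences of a letter add under concatenation, so the eigenvalues multiply on words;
  the rest is bilinearity, one factor at a time.\<close>

lemma rescale_mult [simp]: "rescale i c (f * g) = rescale i c f * rescale i c g"
proof -
  have f: "f \<in> carrier (free_algebra UNIV)" and g: "g \<in> carrier (free_algebra UNIV)" by auto
  have *: "rescale i c (Poly_Mapping.single w a * g)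
    = rescale i c (Poly_Mapping.single w a) * rescale i c g" for w a
    using g by (induction rule: free_algebra_induct)
      (simp_all add: mult_single rescale_single plus_monomial_def power_add distrib_left mult_ac)
  show ?thesis
    using f by (induction rule: free_algebra_induct) (simp_all add: * distrib_right)
qed

lemma rescale_rescale: "rescale i c (rescale i d f) = rescale i (c * d) f"
  by (rule poly_mapping_eqI) (simp add: lookup_rescale power_mult_distrib)

lemma rescale_by_1 [simp]: "rescale i 1 f = f"
  by (rule poly_mapping_eqI) (simp add: lookup_rescale)

lemma rescale_closed: "f \<in> carrier (free_algebra V) \<Longrightarrow> rescale i c f \<in> carrier (free_algebra V)"
  by (auto simp: in_keys_iff lookup_rescale)

lemma rescale_algebra_aut:
  assumes "c \<noteq> 0"
  shows "rescale i c \<in> algebra_aut (free_algebra V)"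
proof -
  have "bij_betw (rescale i c) (carrier (free_algebra V)) (carrier (free_algebra V))"
    using assms
    by (intro bij_betw_byWitness[where f' = "rescale i (inverse c)"])
       (auto simp: rescale_rescale simp del: free_algebra_simps intro: rescale_closed)
  thus ?thesis
    unfolding algebra_aut_def
    by (auto intro!: ring_iso_memI rescale_closed simp del: free_algebra_simps(1))
qed

section \<open>The cyclotomic Hecke algebra\<close>

lemma free_algebra_prod_list_closed:
  "(\<And>j. j \<in> set js \<Longrightarrow> f j \<in> carrier (free_algebra V)) \<Longrightarrow>
    (\<Prod>j\<leftarrow>js. f j) \<in> carrier (free_algebra V)"
  by (induction js) (auto simp: zero_monomial_def simp del: free_algebra_simps(1) intro: free_algebra_mult_closed,
    simp add: zero_monomial_def)

lemma rescale_prod_list: "rescale i c (\<Prod>j\<leftarrow>js. f j) = (\<Prod>j\<leftarrow>js. rescale i c (f j))"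
  by (induction js) simp_all

lemma prod_list_const_mult:
  "(\<Prod>j\<leftarrow>js. nc_const c * f j) = nc_const (c ^ length js) * (\<Prod>j\<leftarrow>js. f j)"
proof (induction js)
  case (Cons j js)
  have "nc_const c * f j * (nc_const (c ^ length js) * g)
    = nc_const c * (nc_const (c ^ length js) * f j) * g" for g
    by (metis nc_const_commute mult.assoc)
  thus ?case using Cons by (simp add: mult.assoc)
qed simp

text \<open>Constants are central and only one letter occurs. This brings the factor displaced by
  the rotation of a block back to its end.\<close>

lemma linear_factor_commute:
  "(nc_var i - nc_const a) * (\<Prod>j\<leftarrow>js. nc_var i - nc_const (u j))
    = (\<Prod>j\<leftarrow>js. nc_var i - nc_const (u j)) * (nc_var i - nc_const a)"
proof (induction js)
  case (Cons j js)
  let ?L = "\<lambda>a. nc_var i - nc_const a" and ?P = "\<Prod>j\<leftarrow>js. nc_var i - nc_const (u j)"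
  have *: "?L a * ?L (u j) = ?L (u j) * ?L a" by (simp add: algebra_simps)
  have "?L a * (?L (u j) * ?P) = ?L (u j) * (?L a * ?P)"
    by (simp only: * flip: mult.assoc)
  also have "\<dots> = ?L (u j) * ?P * ?L a"
    by (simp only: Cons mult.assoc)
  finally show ?case by simp
qed simp

text \<open>Up to the scalar \<open>\<xi> ^ p = 1\<close>, rescaling rotates the list of factors.\<close>

lemma rescale_cyclotomic_block:
  fixes i :: 'a
  assumes "\<xi> ^ p = 1"
  shows "rescale i \<xi> (\<Prod>k\<leftarrow>[0..<p]. nc_var i - nc_const (\<xi> ^ k * y))
    = (\<Prod>k\<leftarrow>[0..<p]. nc_var i - nc_const (\<xi> ^ k * y))"
proof (cases p)
  case (Suc m)
  let ?F = "\<lambda>k. nc_var i - nc_const (\<xi> ^ k * y)"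
  \<comment> \<open>With p = m + 1, this identity makes the factor at 0 wrap around to position
    \<open>m\<close>; the others move down by one.\<close>
  have "nc_const (\<xi> * (\<xi> ^ m * y)) = (nc_const y :: 'a ncpoly)"
    by (metis Suc assms mult.assoc mult_1_left power_Suc)
  hence 0: "rescale i \<xi> (?F 0) = nc_const \<xi> * ?F m"
    by (simp add: right_diff_distrib)
  have S: "rescale i \<xi> (?F (Suc k)) = nc_const \<xi> * ?F k" for k
    by (simp add: right_diff_distrib mult.assoc)
  have "[0..<p] = 0 # map Suc [0..<m]"
    by (simp add: Suc upt_conv_Cons map_Suc_upt del: upt_Suc)
  hence "rescale i \<xi> (\<Prod>k\<leftarrow>[0..<p]. ?F k)
      = rescale i \<xi> (?F 0) * (\<Prod>k\<leftarrow>[0..<m]. rescale i \<xi> (?F (Suc k)))"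
    by (simp only: rescale_prod_list rescale_mult list.map map_map prod_list.Cons o_def)
  also have "\<dots> = nc_const \<xi> * (?F m * (nc_const (\<xi> ^ m) * (\<Prod>k\<leftarrow>[0..<m]. ?F k)))"
    by (simp only: 0 S prod_list_const_mult length_upt diff_zero mult.assoc)
  also have "\<dots> = nc_const \<xi> * (nc_const (\<xi> ^ m) * (?F m * (\<Prod>k\<leftarrow>[0..<m]. ?F k)))"
    by (simp only: nc_const_commute[of "?F m"] flip: mult.assoc)
  also have "\<dots> = nc_const (\<xi> ^ p) * (?F m * (\<Prod>k\<leftarrow>[0..<m]. ?F k))"
    by (simp add: Suc)
  also have "\<dots> = (\<Prod>k\<leftarrow>[0..<m]. ?F k) * ?F m"
    unfolding assms nc_const_1 mult_1_left by (rule linear_factor_commute)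
  also have "\<dots> = (\<Prod>k\<leftarrow>[0..<p]. ?F k)" by (simp add: Suc)
  finally show ?thesis .
qed simp

text \<open>The product is ordered, so each block is a run of consecutive indices l p + 1, ..., l p
  + p; the shift by one comes from numbering the u_j from 1.\<close>

lemma prod_list_blocks:
  fixes g :: "complex \<Rightarrow> 'a::monoid_mult"
  assumes "\<And>l k. \<lbrakk>l < d; k < p\<rbrakk> \<Longrightarrow> u (l * p + k + 1) = v l k"
  shows "(\<Prod>j\<leftarrow>[1..<d * p + 1]. g (u j)) = (\<Prod>l\<leftarrow>[0..<d]. \<Prod>k\<leftarrow>[0..<p]. g (v l k))"
  using assms
proof (induction d)
  case (Suc d)
  have "[1..<Suc d * p + 1] = [1..<d * p + 1] @ [d * p + 1..<p + (d * p + 1)]"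
    using upt_add_eq_append[of 1 "d * p + 1" p] by (simp add: ac_simps del: upt_Suc)
  also have "[d * p + 1..<p + (d * p + 1)] = map (\<lambda>k. k + (d * p + 1)) [0..<p]"
    by (simp only: map_add_upt)
  finally have "(\<Prod>j\<leftarrow>[1..<Suc d * p + 1]. g (u j))
      = (\<Prod>j\<leftarrow>[1..<d * p + 1]. g (u j)) * (\<Prod>k\<leftarrow>[0..<p]. g (u (k + (d * p + 1))))"
    by (simp only: map_append map_map prod_list.append o_def)
  also have "map (\<lambda>k. g (u (k + (d * p + 1)))) [0..<p] = map (\<lambda>k. g (v d k)) [0..<p]"
    using Suc.prems[of d] by (simp add: ac_simps)
  finally show ?case using Suc.IH Suc.prems by simp
qed simp

text \<open>Separates the constant term in order to invert the letter modulo the relation;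
  \<open>Q\<close> commutes with the letter so that the inverse is two-sided.\<close>

lemma linear_factors_constant_term:
  assumes "i \<in> V"
  shows "\<exists>Q\<in>carrier (free_algebra V). nc_var i * Q = Q * nc_var i \<and>
    (\<Prod>j\<leftarrow>js. nc_var i - nc_const (u j)) = nc_var i * Q + nc_const (\<Prod>j\<leftarrow>js. - u j)"
proof (induction js)
  case Nil
  show ?case by (intro bexI[of _ 0]) auto
next
  case (Cons j js)
  then obtain Q where Q: "Q \<in> carrier (free_algebra V)" "nc_var i * Q = Q * nc_var i"
    "(\<Prod>j\<leftarrow>js. nc_var i - nc_const (u j)) = nc_var i * Q + nc_const (\<Prod>j\<leftarrow>js. - u j)" by blast
  let ?c = "\<Prod>j\<leftarrow>js. - u j"
  \<comment> \<open>Read off from (X - u)(X Q + c) = X (X Q + c - u Q) - u c.\<close>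
  let ?Q' = "nc_var i * Q + nc_const ?c - nc_const (u j) * Q"
  have neg: "nc_const (- a * b) = - (nc_const (a * b) :: 'a ncpoly)" for a b
    using nc_const_add[of "- a * b" "a * b"] by (simp add: nc_const_def add_eq_0_iff2 single_uminus)
  have "?Q' \<in> carrier (free_algebra V)"
    using Q(1) assms by (intro free_algebra_closed)
  moreover have "nc_var i * ?Q' = ?Q' * nc_var i"
    by (simp add: distrib_left distrib_right right_diff_distrib left_diff_distrib mult.assoc flip: Q(2))
  moreover have "(nc_var i - nc_const (u j)) * (nc_var i * Q + nc_const ?c)
      = nc_var i * ?Q' + nc_const (- u j * ?c)"
    unfolding neg by (simp add: algebra_simps mult.assoc)
  ultimately show ?case using Q(3) by auto
qed

section \<open>The Hecke algebra: invertibility of T_1, the twist and its fixed points\<close>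

locale hecke =
  fixes r p n d :: nat and q \<xi> :: complex and x u :: "nat \<Rightarrow> complex"
  assumes n: "n > 0" and r: "r = d * p"
    and q: "q \<noteq> 0" and x: "\<And>l. l < d \<Longrightarrow> x l \<noteq> 0"
    and \<xi>: "primitive_root_of_unity p \<xi>"
    and u: "\<And>l k. \<lbrakk>l < d; k < p\<rbrakk> \<Longrightarrow> u (l * p + k + 1) = \<xi> ^ k * x l"
begin

declare One_nat_def [simp del]

lemma p: "p > 0" and \<xi>_pow: "\<xi> ^ p = 1" and \<xi>_nz: "\<xi> \<noteq> 0"
  using \<xi> by (auto simp: primitive_root_of_unity_def power_0_left)

lemma u_nz:
  assumes "j \<in> {1..r}" shows "u j \<noteq> 0"
proof -
  define l k where "l = (j - 1) div p" and "k = (j - 1) mod p"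
  have lk: "l < d" "k < p"
    using assms p by (auto simp: l_def k_def r less_mult_imp_div_less)
  have "j = l * p + k + 1" using assms unfolding l_def k_def by simp
  thus ?thesis using u[OF lk] x[OF lk(1)] \<xi>_nz by simp
qed

abbreviation "R \<equiv> hecke_relations r n u q"

sublocale presentation "{1..n}" R
proof
  have T: "nc_var i \<in> carrier (free_algebra {1..n})" if "i \<in> {1..n}" for i :: nat
    using that by (rule nc_var_closed)
  show "R \<subseteq> carrier (free_algebra {1..n})"
    using n unfolding hecke_relations_def Let_def
    by (auto simp del: free_algebra_simps
        intro!: free_algebra_closed free_algebra_prod_list_closed split: if_splits)
qed

lemma R_prod: "(\<Prod>j\<leftarrow>[1..<r + 1]. nc_var 1 - nc_const (u j)) \<in> R"
  and R_far: "\<lbrakk>i \<in> {1..n}; j \<in> {1..n}; \<bar>int i - int j\<bar> > 1\<rbrakk> \<Longrightarrow>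
    nc_var i * nc_var j - nc_var j * nc_var i \<in> R"
  and R_braid: "2 \<le> n \<Longrightarrow> nc_var 1 * nc_var 2 * nc_var 1 * nc_var 2
    - nc_var 2 * nc_var 1 * nc_var 2 * nc_var 1 \<in> R"
  and R_quad: "\<lbrakk>2 \<le> i; i \<le> n\<rbrakk> \<Longrightarrow> (nc_var i - nc_const q) * (nc_var i + nc_const (inverse q)) \<in> R"
  unfolding hecke_relations_def Let_def by auto

lemma hecke_r1n_eq: "hecke_r1n r n u q = P"
  by (simp add: hecke_r1n_def)

lemma hecke_gen_eq: "hecke_gen r n u q i = pr (nc_var i)"
  by (simp add: hecke_gen_def presented_gen_eq)

lemma var_closed: "i \<in> {1..n} \<Longrightarrow> nc_var i \<in> carrier F"
  by (rule nc_var_closed)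

lemma pr_const: "pr (nc_const c) = c \<odot>\<^bsub>P\<^esub> \<one>\<^bsub>P\<^esub>"
  using pr_hom(5)[OF F.one_closed, of c] pr_hom(4) by simp

text \<open>The cyclotomic relation becomes X Q = -c with c the product of the -u_j, so -Q/c inverts
  X. Hence the \<open>inv\<close> in \<open>hecke_rpn\<close> is a genuine inverse.\<close>

lemma gen1_unit: "pr (nc_var 1) \<in> Units P"
proof -
  let ?X = "nc_var 1 :: nat ncpoly"
  define c where "c = (\<Prod>j\<leftarrow>[1..<r + 1]. - u j)"
  have 1: "1 \<in> {1..n}" using n by simp
  have X: "?X \<in> carrier F" using 1 by (rule var_closed)
  obtain Q where Q: "Q \<in> carrier F" "?X * Q = Q * ?X"
    "(\<Prod>j\<leftarrow>[1..<r + 1]. ?X - nc_const (u j)) = ?X * Q + nc_const c"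
    using linear_factors_constant_term[OF 1] unfolding c_def by blast
  have c: "c \<noteq> 0" using u_nz by (auto simp: c_def prod_list_zero_iff simp del: upt_Suc)
  have "?X * Q - nc_const (- c) \<in> R"
    using R_prod unfolding Q(3) by (simp add: nc_const_def single_uminus)
  hence e: "pr (?X * Q) = (- c) \<odot>\<^bsub>P\<^esub> \<one>\<^bsub>P\<^esub>"
    using pr_relation[of "?X * Q" "nc_const (- c)"] X Q(1) by (simp only: pr_const free_algebra_closed)
  have e1: "pr ?X \<otimes>\<^bsub>P\<^esub> pr Q = (- c) \<odot>\<^bsub>P\<^esub> \<one>\<^bsub>P\<^esub>" "pr Q \<otimes>\<^bsub>P\<^esub> pr ?X = (- c) \<odot>\<^bsub>P\<^esub> \<one>\<^bsub>P\<^esub>"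
    using e pr_hom(2)[OF X Q(1)] pr_hom(2)[OF Q(1) X] Q(2) by simp_all
  let ?Y = "inverse (- c) \<odot>\<^bsub>P\<^esub> pr Q"
  note cl = pr_hom(1)[OF X] pr_hom(1)[OF Q(1)]
  have cc: "inverse (- c) * (- c) = 1" using c by simp
  have "pr ?X \<otimes>\<^bsub>P\<^esub> ?Y = \<one>\<^bsub>P\<^esub>" "?Y \<otimes>\<^bsub>P\<^esub> pr ?X = \<one>\<^bsub>P\<^esub>"
    using cl by (simp_all only: P.smult_mult_right P.smult_mult_left e1 P.smult_assoc[symmetric]
        P.one_closed cc P.smult_one)
  moreover have "?Y \<in> carrier P" using cl by (intro P.smult_closed)
  ultimately show ?thesis using cl unfolding Units_def by blast
qed

lemma rescale_relation: "f \<in> R \<Longrightarrow> \<exists>c. rescale 1 \<xi> f = nc_const c * f"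
proof -
  assume "f \<in> R"
  then consider i j where "f = nc_var i * nc_var j - nc_var j * nc_var i" "\<bar>int i - int j\<bar> > 1"
    | i where "f = nc_var i * nc_var (i + 1) * nc_var i - nc_var (i + 1) * nc_var i * nc_var (i + 1)"
        "2 \<le> i"
    | "f = nc_var 1 * nc_var 2 * nc_var 1 * nc_var 2 - nc_var 2 * nc_var 1 * nc_var 2 * nc_var 1"
    | "f = (\<Prod>j\<leftarrow>[1..<r + 1]. nc_var 1 - nc_const (u j))"
    | i where "f = (nc_var i - nc_const q) * (nc_var i + nc_const (inverse q))" "2 \<le> i"
    unfolding hecke_relations_def Let_def
    by (elim UnE) (auto split: if_splits)
  thus ?thesis
  proof cases
    case 1
    \<comment> \<open>At most one of \<open>i\<close>, \<open>j\<close> is 1, since they differ by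
      more than 1.\<close>
    have "rescale 1 \<xi> f = nc_const (if i = 1 \<or> j = 1 then \<xi> else 1) * f"
      using 1 by (auto simp: right_diff_distrib mult.assoc)
    thus ?thesis ..
  next
    case 2
    hence "rescale 1 \<xi> f = nc_const 1 * f" by simp
    thus ?thesis ..
  next
    case 3
    \<comment> \<open>T_1 occurs twice in each of the two words.\<close>
    have "rescale 1 \<xi> f = nc_const (\<xi> * \<xi>) * f"
      unfolding 3 by (simp add: right_diff_distrib mult.assoc)
    thus ?thesis ..
  next
    case 4
    have f: "f = (\<Prod>l\<leftarrow>[0..<d]. \<Prod>k\<leftarrow>[0..<p]. nc_var 1 - nc_const (\<xi> ^ k * x l))"
      unfolding 4 r using u by (rule prod_list_blocks)
    have "rescale 1 \<xi> f = nc_const 1 * f"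
      unfolding f rescale_prod_list[of _ _ _ "[0..<d]"] rescale_cyclotomic_block[OF \<xi>_pow] by simp
    thus ?thesis ..
  next
    case 5
    hence "rescale 1 \<xi> f = nc_const 1 * f" by simp
    thus ?thesis ..
  qed
qed

text \<open>The preimage of \<open>J\<close> under one rescaling is an ideal containing the
  relations, so it contains \<open>J\<close>; powers follow by iteration.\<close>

lemma rescale_ideal: "f \<in> J \<Longrightarrow> rescale 1 (\<xi> ^ m) f \<in> J"
proof (induction m)
  case (Suc m)
  interpret h: ring_hom_ring F F "rescale 1 \<xi>"
    using rescale_algebra_aut[OF \<xi>_nz, of 1 "{1..n}"]
    by (intro ring_hom_ringI2 F.ring_axioms) (simp add: algebra_aut_def ring_iso_def)
  have "R \<subseteq> {f \<in> carrier F. rescale 1 \<xi> f \<in> J}"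
  proof
    fix f assume f: "f \<in> R"
    obtain c where c: "rescale 1 \<xi> f = nc_const c * f" using rescale_relation[OF f] by blast
    have "f \<in> J" using F.genideal_self[OF relations_closed] f by blast
    from F.ideal_smult_closed[OF ideal this, of c] have "rescale 1 \<xi> f \<in> J"
      by (simp add: c)
    thus "f \<in> {f \<in> carrier F. rescale 1 \<xi> f \<in> J}" using f relations_closed by blast
  qed
  hence "J \<subseteq> {f \<in> carrier F. rescale 1 \<xi> f \<in> J}"
    by (intro F.genideal_minimal h.ideal_vimage ideal)
  hence "rescale 1 \<xi> (rescale 1 (\<xi> ^ m) f) \<in> J" using Suc by blast
  thus ?case by (simp add: rescale_rescale)
qed simp

text \<open>The inverse of \<xi>^m is \<xi>^(m(p-1)), again a nonnegative power, so the inclusion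
  just proved also yields surjectivity.\<close>

lemma rescale_image_ideal: "rescale 1 (\<xi> ^ m) ` J = J"
proof
  show "rescale 1 (\<xi> ^ m) ` J \<subseteq> J" using rescale_ideal by blast
  show "J \<subseteq> rescale 1 (\<xi> ^ m) ` J"
  proof
    fix f assume f: "f \<in> J"
    have "m + m * (p - 1) = p * m" using p by (cases p) simp_all
    hence "\<xi> ^ m * \<xi> ^ (m * (p - 1)) = (\<xi> ^ p) ^ m"
      by (metis power_add power_mult)
    hence "f = rescale 1 (\<xi> ^ m) (rescale 1 (\<xi> ^ (m * (p - 1))) f)"
      by (simp add: rescale_rescale \<xi>_pow)
    thus "f \<in> rescale 1 (\<xi> ^ m) ` J" using rescale_ideal[OF f] by blast
  qed
qed

text \<open>Group elements are the integers from 0 to p - 1, on which \<open>nat h\<close> loses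
  nothing.\<close>

definition twist :: "int \<Rightarrow> nat ncpoly set \<Rightarrow> nat ncpoly set" where
  "twist h = restrict (image (rescale 1 (\<xi> ^ nat h))) (carrier P)"

lemma twist_aut: "twist h \<in> algebra_aut P"
  and twist_pr: "f \<in> carrier F \<Longrightarrow> twist h (pr f) = pr (rescale 1 (\<xi> ^ nat h) f)"
proof -
  have a: "rescale 1 (\<xi> ^ nat h) \<in> algebra_aut F" by (rule rescale_algebra_aut) (simp add: \<xi>_nz)
  note qa = F.quotient_aut[OF ideal a rescale_image_ideal]
  show "twist h \<in> algebra_aut P"
    using qa(1) unfolding twist_def presented_algebra_def .
  assume f: "f \<in> carrier F"
  show "twist h (pr f) = pr (rescale 1 (\<xi> ^ nat h) f)"
    using qa(2)[OF f] pr_hom(1)[OF f] by (simp add: twist_def)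
qed

lemma \<xi>_pow_mod: "\<xi> ^ (m mod p) = \<xi> ^ m"
proof -
  have "\<xi> ^ m = \<xi> ^ (p * (m div p) + m mod p)" by simp
  also have "\<dots> = \<xi> ^ (m mod p)" by (simp only: power_add power_mult \<xi>_pow) simp
  finally show ?thesis by simp
qed

text \<open>Rescalings compose by multiplying their factors, and reduction of exponents mod p is
  harmless because \<xi>^p = 1.\<close>

lemma twist_group_action: "group_action (integer_mod_group p) (carrier P) twist"
proof -
  have Bij: "twist h \<in> Bij (carrier P)" for h
    using twist_aut[of h] by (auto simp: Bij_def twist_def algebra_aut_def ring_iso_def)
  have "twist ((g + h) mod int p) = compose (carrier P) (twist g) (twist h)"
    if gh: "0 \<le> g" "0 \<le> h" for g h
  proof (rule extensionalityI[of _ "carrier P"])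
    fix B assume "B \<in> carrier P"
    then obtain f where f: "f \<in> carrier F" "B = pr f" by (rule presented_carrierE)
    have "nat ((g + h) mod int p) = (nat g + nat h) mod p"
      using gh by (simp add: nat_mod_distrib nat_add_distrib)
    hence "\<xi> ^ nat ((g + h) mod int p) = \<xi> ^ nat g * \<xi> ^ nat h"
      by (simp add: \<xi>_pow_mod power_add)
    thus "twist ((g + h) mod int p) B = compose (carrier P) (twist g) (twist h) B"
      using f \<open>B \<in> carrier P\<close> rescale_closed[OF f(1)]
      by (simp add: compose_eq twist_pr rescale_rescale del: free_algebra_simps)
  qed (simp_all add: twist_def)
  hence "twist \<in> hom (integer_mod_group p) (BijGroup (carrier P))"
    using p Bij by (intro homI) (auto simp: BijGroup_def carrier_integer_mod_group)
  thus ?thesis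
    by (simp add: group_action_def group_hom_def group_hom_axioms_def group_BijGroup)
qed

lemma twist_action_twist: "twist_action r p n u q \<xi> twist"
proof -
  \<comment> \<open>For p = 1 the generator is 0, and the equation still holds because then \<xi> =
    1.\<close>
  have g: "\<xi> ^ nat (1 mod int p) = \<xi>"
    using \<xi>_pow_mod[of 1] by (simp only: nat_mod_distrib nat_int nat_one_as_int[symmetric] power_one_right)
  have "pr (nc_const \<xi> * nc_var 1) = \<xi> \<odot>\<^bsub>P\<^esub> pr (nc_var 1)"
    using n by (intro pr_hom(5) var_closed) simp
  hence "twist (1 mod int p) (pr (nc_var 1)) = \<xi> \<odot>\<^bsub>P\<^esub> pr (nc_var 1)"
    using n by (subst twist_pr) (simp_all add: g var_closed del: free_algebra_simps)
  moreover have "twist (1 mod int p) (pr (nc_var i)) = pr (nc_var i)" if "i \<in> {2..n}" for i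
    using that by (subst twist_pr) (auto simp: g intro!: var_closed simp del: free_algebra_simps)
  ultimately show ?thesis
    unfolding twist_action_def Let_def hecke_r1n_eq hecke_gen_eq
    by (simp add: algebra_action_def twist_group_action twist_aut)
qed

text \<open>The residue of 1 generates the group, so an arbitrary action enters the argument only
  through this one automorphism.\<close>

lemma fixed_points_cyclic:
  assumes "group_action (integer_mod_group p) E \<phi>" and "a \<in> E"
  shows "(\<forall>g\<in>carrier (integer_mod_group p). \<phi> g a = a) \<longleftrightarrow> \<phi> (1 mod int p) a = a"
proof -
  interpret group_action "integer_mod_group p" E \<phi> by fact
  have "\<phi> (int m) a = a" if "m < p" and 1: "\<phi> (1 mod int p) a = a" for m
    using that(1)
  proof (induction m)
    case 0
    show ?case using id_eq_one \<open>a \<in> E\<close> by (metis one_integer_mod_group of_nat_0 restrict_apply')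
  next
    case (Suc m)
    have "\<phi> ((1 mod int p) \<otimes>\<^bsub>integer_mod_group p\<^esub> int m) a = \<phi> (1 mod int p) (\<phi> (int m) a)"
      using \<open>a \<in> E\<close> Suc.prems by (intro composition_rule) (auto simp: carrier_integer_mod_group)
    moreover have "(1 mod int p + int m) mod int p = int (Suc m)"
      using Suc.prems by (simp add: mod_simps)
    ultimately show ?case using Suc 1 by simp
  qed
  moreover have "h = int (nat h) \<and> nat h < p" if "h \<in> carrier (integer_mod_group p)" for h
    using that p by (auto simp: carrier_integer_mod_group)
  moreover have "1 mod int p \<in> carrier (integer_mod_group p)"
    using p by (simp add: carrier_integer_mod_group)
  ultimately show ?thesis by metis
qed

lemma hecke_rpn_eq_fixed_points:
  assumes "twist_action r p n u q \<xi> \<phi>"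
  shows "hecke_rpn r p n u q = fixed_points (integer_mod_group p) (hecke_r1n r n u q) \<phi>"
proof -
  let ?f = "\<phi> (1 mod int p)"
  let ?t = "pr (nc_var 1)" and ?s = "\<lambda>i. pr (nc_var i)"
  have act: "group_action (integer_mod_group p) (carrier P) \<phi>"
    and aut: "?f \<in> algebra_aut P"
    and ft: "?f ?t = \<xi> \<odot>\<^bsub>P\<^esub> ?t" and fs: "\<And>i. i \<in> {2..n} \<Longrightarrow> ?f (?s i) = ?s i"
    using assms p unfolding twist_action_def Let_def hecke_r1n_eq hecke_gen_eq algebra_action_def
    by (auto simp: carrier_integer_mod_group)
  have s: "?s i \<in> carrier P" if "i \<in> {1..n}" for i
    using that by (intro pr_hom var_closed)
  have far: "?t \<otimes>\<^bsub>P\<^esub> ?s i = ?s i \<otimes>\<^bsub>P\<^esub> ?t" if "i \<in> {3..n}" for i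
  proof -
    have "pr (nc_var 1 * nc_var i) = pr (nc_var i * nc_var 1)"
      using that by (intro pr_relation R_far free_algebra_mult_closed var_closed) auto
    thus ?thesis using that pr_hom(2) var_closed by (simp del: free_algebra_simps)
  qed
  have br: "?t \<otimes>\<^bsub>P\<^esub> ?s 2 \<otimes>\<^bsub>P\<^esub> ?t \<otimes>\<^bsub>P\<^esub> ?s 2 = ?s 2 \<otimes>\<^bsub>P\<^esub> ?t \<otimes>\<^bsub>P\<^esub> ?s 2 \<otimes>\<^bsub>P\<^esub> ?t"
    if "2 \<le> n"
  proof -
    have c: "nc_var 1 \<in> carrier F" "nc_var 2 \<in> carrier F" using that by (auto intro!: var_closed simp del: free_algebra_simps)
    have "pr (nc_var 1 * nc_var 2 * nc_var 1 * nc_var 2) = pr (nc_var 2 * nc_var 1 * nc_var 2 * nc_var 1)"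
      using that c by (intro pr_relation R_braid free_algebra_mult_closed)
    thus ?thesis using c by (simp only: pr_hom(2) free_algebra_mult_closed)
  qed
  \<comment> \<open>Expanding (T_2 - q)(T_2 + q^{-1}) = 0 gives (T_2 + (q^{-1} - q)) T_2 =
    1.\<close>
  let ?c = "inverse q - q"
  have quad: "(?s 2 \<oplus>\<^bsub>P\<^esub> ?c \<odot>\<^bsub>P\<^esub> \<one>\<^bsub>P\<^esub>) \<otimes>\<^bsub>P\<^esub> ?s 2 = \<one>\<^bsub>P\<^esub>" if "2 \<le> n"
  proof -
    let ?Y = "nc_var 2 :: nat ncpoly"
    have c: "?Y \<in> carrier F" using that by (auto intro!: var_closed simp del: free_algebra_simps)
    have "nc_const (inverse q) = nc_const ?c + (nc_const q :: nat ncpoly)"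
      by (simp flip: nc_const_add)
    hence "(?Y - nc_const q) * (?Y + nc_const (inverse q)) = (?Y + nc_const ?c) * ?Y - nc_const (q * inverse q)"
      by (simp add: distrib_left distrib_right left_diff_distrib nc_const_mult[symmetric] del: nc_const_mult)
    hence "(?Y + nc_const ?c) * ?Y - 1 \<in> R" using R_quad[of 2] that q by simp
    hence "pr ((?Y + nc_const ?c) * ?Y) = pr 1"
      using that F.one_closed by (intro pr_relation free_algebra_closed) simp_all
    thus ?thesis
      using c by (simp only: pr_hom(2-4) pr_const free_algebra_closed)
  qed
  have "presented_gen {1..n} R ` {1..n} = insert ?t (?s ` {2..n})"
  proof -
    have "{1..n} = insert 1 {2..n}" using n by auto
    hence "presented_gen {1..n} R ` {1..n} = presented_gen {1..n} R ` insert 1 {2..n}"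
      by (rule arg_cong)
    thus ?thesis by (simp add: presented_gen_eq)
  qed
  hence gen: "generated_subalgebra P (insert ?t (?s ` {2..n})) = carrier P"
    using generated_subalgebra_gens by simp
  have "hecke_rpn r p n u q = {a \<in> carrier P. ?f a = a}"
    unfolding hecke_rpn_def Let_def hecke_r1n_eq hecke_gen_eq
    using s by (intro P.twist_fixed_points_eq_generated[OF gen1_unit _ far br quad gen aut ft fs \<xi>]) simp_all
  thus ?thesis
    unfolding fixed_points_def hecke_r1n_eq using fixed_points_cyclic[OF act] by blast
qed

end

theorem mainTheorem1:
  fixes r p n d :: nat and q \<xi> :: complex and x u :: "nat \<Rightarrow> complex"
  assumes "r > 0" and "p > 0" and "n > 0"
    and "p dvd r" and "d = r div p"
    and "q \<noteq> 0"
    and "\<And>l. l < d \<Longrightarrow> x l \<noteq> 0"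
    and "primitive_root_of_unity p \<xi>"
    and "\<And>j k l. j \<in> {1..r} \<Longrightarrow> j - 1 = l * p + k \<Longrightarrow> k \<le> p - 1 \<Longrightarrow> l \<le> d - 1
           \<Longrightarrow> u j = \<xi> ^ k * x l"
  shows "(\<exists>\<phi>. twist_action r p n u q \<xi> \<phi>) \<and>
    (\<forall>\<phi>. twist_action r p n u q \<xi> \<phi> \<longrightarrow>
      hecke_rpn r p n u q = fixed_points (integer_mod_group p) (hecke_r1n r n u q) \<phi>)"
proof -
  have r: "r = d * p" using assms(4,5) by simp
  have u: "u (l * p + k + 1) = \<xi> ^ k * x l" if "l < d" "k < p" for l k
  proof (rule assms(9))
    have "l * p + k + 1 \<le> Suc l * p" using that(2) by simp
    also have "\<dots> \<le> d * p" using that(1) by (intro mult_le_mono1) simp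
    finally show "l * p + k + 1 \<in> {1..r}" by (simp add: r)
  qed (use that in auto)
  interpret hecke r p n d q \<xi> x u
    by (rule hecke.intro) (fact assms(3,6-8) r u)+
  show ?thesis using twist_action_twist hecke_rpn_eq_fixed_points by blast
qed

end
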